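(* There is a function $F:[\omega_1]^{<\omega}\to\omega$ such that: (a) if $F(A)=F(B)$ then $|A|=|B|$; (b) if $F(A)=F(B)$ then $A\cap B$ is an initial segment of $A$ and an initial segment of $B$ (with respect to the ordinal ordering); (c) there do not exist $A_0,B_0,A_1,B_1\in[\omega_1]^{<\omega}$ such that $A_0\cup B_0=A_1\cup B_1$, $F(A_0)=F(B_0)$, $F(A_1)=F(B_1)$, $A_0\neq B_0$, $A_1\neq B_1$, and $\{A_0,B_0\}\neq\{A_1,B_1\}$.
   Context: $\omega_1$ is the first uncountable ordinal, identified with the set of smaller ordinals; $[\omega_1]^{<\omega}$ denotes the set of finite subsets of $\omega_1$, and $\omega$ is the set of natural numbers. *)

theory Defs
  imports "HOL-Library.Countable_Set_Type"
begin

unbundle cardinal_syntax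

text \<open>The first uncountable ordinal: the initial ordinal of the successor cardinal of
  \<open>\<aleph>\<^sub>0\<close>. As \<open>cardSuc\<close> is only determined up to order isomorphism, the facts
  \<open>uncountable_omega1\<close> and \<open>countable_lessThan_omega1\<close> record that the resulting well-order is
  \<open>\<omega>\<^sub>1\<close>.\<close>

lemma Well_order_cardSuc_natLeq: "Well_order (cardSuc natLeq)"
  using cardSuc_Card_order[OF natLeq_Card_order] card_order_on_well_order_on by blast

lemma Field_cardSuc_natLeq_uncountable: "uncountable (Field (cardSuc natLeq))"
proof
  assume "countable (Field (cardSuc natLeq))"
  then have "|Field (cardSuc natLeq)| \<le>o natLeq"
    by (simp add: countable_card_le_natLeq)
  moreover have "|Field (cardSuc natLeq)| =o cardSuc natLeq"
    using cardSuc_Card_order[OF natLeq_Card_order] card_of_Field_ordIso by blast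
  ultimately have "cardSuc natLeq \<le>o natLeq"
    using ordIso_symmetric ordIso_ordLeq_trans by blast
  then show False
    using cardSuc_greater[OF natLeq_Card_order] not_ordLess_ordLeq by blast
qed

typedef omega1 = "Field (cardSuc natLeq)"
  using Field_cardSuc_natLeq_uncountable by (metis countable_empty ex_in_conv)

instantiation omega1 :: wellorder
begin

definition less_eq_omega1 :: "omega1 \<Rightarrow> omega1 \<Rightarrow> bool" where
  "x \<le> y \<longleftrightarrow> (Rep_omega1 x, Rep_omega1 y) \<in> cardSuc natLeq"

definition less_omega1 :: "omega1 \<Rightarrow> omega1 \<Rightarrow> bool" where
  "x < y \<longleftrightarrow> x \<le> y \<and> x \<noteq> (y :: omega1)"

instance
proof
  have lin: "Linear_order (cardSuc natLeq)"
    using Well_order_cardSuc_natLeq by (auto simp: well_order_on_def)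
  have refl: "Refl (cardSuc natLeq)" and trans: "trans (cardSuc natLeq)"
    and antisym: "antisym (cardSuc natLeq)" and tot: "Total (cardSuc natLeq)"
    using lin by (auto simp: linear_order_on_def partial_order_on_def preorder_on_def)
  fix x y z :: omega1
  show le_refl: "x \<le> x"
    using refl Rep_omega1[of x] by (auto simp: less_eq_omega1_def refl_on_def)
  show "x \<le> y \<Longrightarrow> y \<le> z \<Longrightarrow> x \<le> z"
    using trans by (auto simp: less_eq_omega1_def dest: transD)
  show le_antisym: "x \<le> y \<Longrightarrow> y \<le> x \<Longrightarrow> x = y"
    using antisym by (auto simp: less_eq_omega1_def Rep_omega1_inject[symmetric] dest: antisymD)
  show "x < y \<longleftrightarrow> x \<le> y \<and> \<not> y \<le> x"
    using le_antisym le_refl by (auto simp: less_omega1_def)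
  show "x \<le> y \<or> y \<le> x"
    using tot le_refl Rep_omega1[of x] Rep_omega1[of y]
    by (cases "x = y") (auto simp: less_eq_omega1_def total_on_def Rep_omega1_inject)
next
  fix P :: "omega1 \<Rightarrow> bool" and a :: omega1
  assume step: "\<And>x. (\<And>y. y < x \<Longrightarrow> P y) \<Longrightarrow> P x"
  have "wf (inv_image (cardSuc natLeq - Id) Rep_omega1)"
    using Well_order_cardSuc_natLeq by (auto simp: well_order_on_def)
  then show "P a"
  proof (induction a rule: wf_induct_rule)
    case (less x)
    show ?case
    proof (rule step)
      fix y assume "y < x"
      then show "P y"
        by (intro less) (simp add: less_omega1_def less_eq_omega1_def Rep_omega1_inject)
    qed
  qed
qed

end

lemma uncountable_omega1: "uncountable (UNIV :: omega1 set)"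
proof
  assume "countable (UNIV :: omega1 set)"
  then have "countable (range Rep_omega1)"
    by (rule countable_image)
  then show False
    using Field_cardSuc_natLeq_uncountable type_definition.Rep_range[OF type_definition_omega1]
    by simp
qed

lemma countable_lessThan_omega1: "countable {..<x :: omega1}"
proof -
  have "|underS (cardSuc natLeq) (Rep_omega1 x)| <o cardSuc natLeq"
    using cardSuc_Card_order[OF natLeq_Card_order] Rep_omega1 by (rule card_of_underS)
  then have "|underS (cardSuc natLeq) (Rep_omega1 x)| \<le>o natLeq"
    using cardSuc_ordLeq_ordLess[OF natLeq_Card_order card_of_Card_order] by blast
  then have "countable (underS (cardSuc natLeq) (Rep_omega1 x))"
    by (simp add: countable_card_le_natLeq)
  moreover have "Rep_omega1 ` {..<x} \<subseteq> underS (cardSuc natLeq) (Rep_omega1 x)"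
    by (auto simp: underS_def less_omega1_def less_eq_omega1_def Rep_omega1_inject)
  ultimately have "countable (Rep_omega1 ` {..<x})"
    using countable_subset by blast
  then show ?thesis
    by (rule countable_image_inj_on) (simp add: inj_on_def Rep_omega1_inject)
qed

definition initial_segment :: "'a::linorder set \<Rightarrow> 'a set \<Rightarrow> bool" where
  "initial_segment S A \<longleftrightarrow> S \<subseteq> A \<and> (\<forall>x\<in>S. \<forall>y\<in>A. y < x \<longrightarrow> y \<in> S)"

end

theory Submission
  imports Defs
begin

text \<open>Fix injections of every proper initial segment \<open>{..<y}\<close> into \<open>\<nat>\<close>, written \<open>e y\<close>, and
  distinct subsets \<open>r x\<close> of \<open>\<nat>\<close>. The colour of \<open>A\<close> records a number \<open>N\<close>, the traces below \<open>N\<close> of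
  \<open>r x\<close> and of the order pattern that \<open>e x\<close> induces on \<open>\<nat>\<close>, for all \<open>x \<in> A\<close>, and the values \<open>e y x\<close>
  for \<open>x < y\<close> in \<open>A\<close>; here \<open>N\<close> is so large that distinct elements of \<open>A\<close> have distinct traces and
  all these values are below \<open>N\<close>. If \<open>A\<close> and \<open>B\<close> have the same colour, then equality of traces
  is an order isomorphism from \<open>A\<close> to \<open>B\<close> that fixes \<open>A \<inter> B\<close>, and injectivity of \<open>e y\<close> gives (b).

  For (c), let \<open>N\<^sub>0 \<le> N\<^sub>1\<close> belong to the two pairs. Two distinct elements of the union that are
  matched by the second pair have the same trace below \<open>N\<^sub>1\<close>, hence below \<open>N\<^sub>0\<close>, so they are matched
  by the first pair. If \<open>c, d\<close> are matched by both and \<open>x, y\<close> only by the first, then \<open>x, y\<close> lie in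
  the common part of the second pair and \<open>e d x = e c x = e d y\<close>, so \<open>x = y\<close>. If \<open>c, d\<close> and
  \<open>x, y\<close> are matched by both pairs but distributed differently, then \<open>e c x = e d y\<close> and
  \<open>e c y = e d x\<close>, so the order patterns of \<open>c\<close> and \<open>d\<close> disagree at these two values,
  both of which are below \<open>N\<^sub>1\<close>.\<close>

locale segment_coding =
  fixes e :: "'a::linorder \<Rightarrow> 'a \<Rightarrow> nat" and r :: "'a \<Rightarrow> nat set"
  assumes inj_e: "inj_on (e y) {..<y}" and inj_r: "inj r"
begin

section \<open>Order patterns and their finite traces\<close>

lemma e_eqD: "e z x = e z y \<Longrightarrow> x < z \<Longrightarrow> y < z \<Longrightarrow> x = y"
  using inj_e[of z] by (auto dest: inj_onD)

text \<open>The two parts do not interfere: as \<open>e x\<close> is injective below \<open>x\<close>, the order part is off the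
  diagonal.\<close>

definition pattern :: "'a \<Rightarrow> (nat \<times> nat) set" where
  "pattern x = {(p, p) |p. p \<in> r x} \<union> {(e x a, e x b) |a b. a < b \<and> b < x}"

lemma pattern_diag: "(p, p) \<in> pattern x \<longleftrightarrow> p \<in> r x"
proof -
  have "a = b" if "e x a = e x b" "a < b" "b < x" for a b
    using that e_eqD[of x a b] by auto
  then show ?thesis
    unfolding pattern_def by (smt (verit) Un_iff mem_Collect_eq order_less_irrefl prod.inject)
qed

text \<open>By injectivity of \<open>e x\<close>, only \<open>a\<close> and \<open>b\<close> have
  these codes below \<open>x\<close>, and \<open>a \<noteq> b\<close> keeps the pair off the
  diagonal.\<close>

lemma pattern_iff_less:
  assumes "a < x" "b < x" "a \<noteq> b"
  shows "(e x a, e x b) \<in> pattern x \<longleftrightarrow> a < b"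
proof -
  have "e x a \<noteq> e x b"
    using assms e_eqD by blast
  moreover have "a < b" if "e x a = e x a'" "e x b = e x b'" "a' < b'" "b' < x" for a' b'
  proof -
    have "a = a'" "b = b'"
      using that assms e_eqD[of x a a'] e_eqD[of x b b'] by auto
    then show ?thesis
      using that by simp
  qed
  ultimately show ?thesis
    using assms by (auto simp: pattern_def)
qed

lemma inj_pattern: "inj pattern"
proof (rule injI)
  fix x y assume "pattern x = pattern y"
  then have "r x = r y"
    using pattern_diag by blast
  then show "x = y"
    using inj_r by (auto dest: injD)
qed

definition trace :: "nat \<Rightarrow> 'a \<Rightarrow> (nat \<times> nat) set" where
  "trace N x = pattern x \<inter> {..<N} \<times> {..<N}"

lemma finite_trace: "finite (trace N x)"
  by (simp add: trace_def)

lemma trace_mono: "trace N x = trace N y \<Longrightarrow> M \<le> N \<Longrightarrow> trace M x = trace M y"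
proof -
  assume eq: "trace N x = trace N y" and "M \<le> N"
  have "trace M z = trace N z \<inter> {..<M} \<times> {..<M}" for z
    using \<open>M \<le> N\<close> by (auto simp: trace_def)
  then show ?thesis
    using eq by simp
qed

definition separates :: "nat \<Rightarrow> 'a set \<Rightarrow> bool" where
  "separates N A \<longleftrightarrow> inj_on (trace N) A \<and> (\<forall>x\<in>A. \<forall>y\<in>A. x < y \<longrightarrow> e y x < N)"

text \<open>Each requirement on a pair holds for all large \<open>N\<close>, and there are finitely
  many pairs.\<close>

lemma ex_separates:
  assumes "finite A"
  shows "\<exists>N. separates N A"
proof -
  have "\<forall>\<^sub>F N in sequentially. (trace N x = trace N y \<longrightarrow> x = y) \<and> e y x < N" for x y
  proof (rule eventually_conj)
    show "\<forall>\<^sub>F N in sequentially. trace N x = trace N y \<longrightarrow> x = y"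
    proof (cases "x = y")
      case False
      then have "pattern x \<noteq> pattern y"
        using inj_pattern by (auto dest: injD)
      then obtain p q where "(p, q) \<in> pattern x \<longleftrightarrow> (p, q) \<notin> pattern y"
        by auto
      then have "(p, q) \<in> trace N x \<longleftrightarrow> (p, q) \<notin> trace N y" if "N \<ge> Suc (max p q)" for N
        using that by (auto simp: trace_def)
      then have "trace N x \<noteq> trace N y" if "N \<ge> Suc (max p q)" for N
        using that by blast
      then show ?thesis
        unfolding eventually_sequentially by blast
    qed simp
    show "\<forall>\<^sub>F N in sequentially. e y x < N"
      by (rule eventually_gt_at_top)
  qed
  then have "\<forall>\<^sub>F N in sequentially. \<forall>x\<in>A. \<forall>y\<in>A. (trace N x = trace N y \<longrightarrow> x = y) \<and> e y x < N"
    using assms by (intro eventually_ball_finite ballI)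
  then have "\<forall>\<^sub>F N in sequentially. separates N A"
    by (rule eventually_mono) (auto simp: separates_def inj_on_def)
  then show ?thesis
    by (auto simp: eventually_sequentially)
qed

text \<open>Elements enter only through traces and codes, so that diagrams of different sets can be
  compared.\<close>

definition diagram :: "nat \<Rightarrow> 'a set \<Rightarrow> ((nat \<times> nat) set \<times> (nat \<times> nat) set \<times> nat) set" where
  "diagram N A = {(trace N x, trace N y, e y x) |x y. x \<in> A \<and> y \<in> A \<and> x < y}"

lemma finite_diagram:
  assumes "finite A"
  shows "finite (diagram N A)"
proof (rule finite_subset)
  show "diagram N A \<subseteq> (\<lambda>(x, y). (trace N x, trace N y, e y x)) ` (A \<times> A)"
    by (auto simp: diagram_def)
qed (use assms in simp)

section \<open>Matched sets: conditions (a) and (b)\<close>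

definition matched :: "nat \<Rightarrow> 'a set \<Rightarrow> 'a set \<Rightarrow> bool" where
  "matched N A B \<longleftrightarrow> separates N A \<and> separates N B \<and>
    trace N ` A = trace N ` B \<and> diagram N A = diagram N B"

lemma matched_sym: "matched N A B \<Longrightarrow> matched N B A"
  by (auto simp: matched_def)

text \<open>The diagram entry of \<open>x, x'\<close> also occurs for \<open>B\<close>, where
  separation leaves only \<open>y, y'\<close> as its source.\<close>

lemma matched_less:
  assumes "matched N A B" "x \<in> A" "x' \<in> A" "y \<in> B" "y' \<in> B"
    and "trace N x = trace N y" "trace N x' = trace N y'" "x < x'"
  shows "y < y'" and "e y' y = e x' x" and "e x' x < N"
proof -
  have inj: "inj_on (trace N) B"
    using assms by (simp add: matched_def separates_def)
  have "(trace N x, trace N x', e x' x) \<in> diagram N A"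
    using assms by (auto simp: diagram_def)
  then have "(trace N x, trace N x', e x' x) \<in> diagram N B"
    using assms by (simp add: matched_def)
  then obtain z z' where "z \<in> B" "z' \<in> B" "z < z'" "e z' z = e x' x"
    and "trace N z = trace N x" "trace N z' = trace N x'"
    by (auto simp: diagram_def)
  moreover from this have "z = y" "z' = y'"
    using assms inj by (auto dest: inj_onD)
  ultimately show "y < y'" "e y' y = e x' x"
    by simp_all
  show "e x' x < N"
    using assms by (auto simp: matched_def separates_def)
qed

lemma matched_card: "matched N A B \<Longrightarrow> card A = card B"
  by (metis card_image matched_def separates_def)

text \<open>A common element \<open>x\<close> is its own partner, so the partner of any
  \<open>y < x\<close> has the same code under \<open>e x\<close> and is \<open>y\<close>
  itself.\<close>

lemma matched_initial_segment:
  assumes "matched N A B"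
  shows "initial_segment (A \<inter> B) A"
  unfolding initial_segment_def
proof (intro conjI ballI impI)
  fix x y assume "x \<in> A \<inter> B" "y \<in> A" "y < x"
  moreover have "trace N y \<in> trace N ` B"
    using assms \<open>y \<in> A\<close> by (auto simp: matched_def)
  then obtain z where "z \<in> B" "trace N y = trace N z"
    by auto
  ultimately have "z < x" "e x z = e x y"
    using matched_less[OF assms, of y x z x] by auto
  then have "z = y"
    using \<open>y < x\<close> e_eqD by blast
  then show "y \<in> A \<inter> B"
    using \<open>y \<in> A\<close> \<open>z \<in> B\<close> by simp
qed simp

lemma matched_partner:
  assumes "matched N A B" "x \<in> A - B"
  obtains y where "y \<in> B - A" "trace N x = trace N y"
proof -
  have "trace N x \<in> trace N ` B"
    using assms by (auto simp: matched_def)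
  then obtain y where y: "y \<in> B" "trace N x = trace N y"
    by auto
  moreover have "y \<notin> A"
  proof
    assume "y \<in> A"
    then have "x = y"
      using assms y by (auto simp: matched_def separates_def dest: inj_onD)
    then show False
      using y assms by simp
  qed
  ultimately show ?thesis
    using that by blast
qed

lemma matched_split:
  assumes "matched N A B" "x \<in> A \<union> B" "y \<in> A \<union> B" "trace N x = trace N y" "x \<noteq> y"
  shows "x \<in> A - B \<and> y \<in> B - A \<or> x \<in> B - A \<and> y \<in> A - B"
proof -
  have "inj_on (trace N) A" "inj_on (trace N) B"
    using assms by (auto simp: matched_def separates_def)
  then have "\<not> (x \<in> A \<and> y \<in> A)" "\<not> (x \<in> B \<and> y \<in> B)"
    using assms by (auto dest: inj_onD)
  then show ?thesis
    using assms by blast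
qed

lemma matched_neq_obtains:
  assumes "matched N A B" "A \<noteq> B"
  obtains c d where "c \<in> A - B" "d \<in> B - A" "trace N c = trace N d"
proof (cases "A \<subseteq> B")
  case False
  then show ?thesis
    using matched_partner[OF assms(1)] that by blast
next
  case True
  then obtain d where "d \<in> B - A"
    using assms by blast
  then show ?thesis
    using matched_partner[OF matched_sym[OF assms(1)]] that by metis
qed

section \<open>Two matched pairs with the same union: condition (c)\<close>

lemma no_crossing:
  assumes A0: "matched N\<^sub>0 A\<^sub>0 B\<^sub>0" and A1: "matched N\<^sub>1 A\<^sub>1 B\<^sub>1" and le: "N\<^sub>0 \<le> N\<^sub>1"
    and "x \<in> A\<^sub>0" "c \<in> A\<^sub>0" "y \<in> B\<^sub>0" "d \<in> B\<^sub>0"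
    and "y \<in> A\<^sub>1" "c \<in> A\<^sub>1" "x \<in> B\<^sub>1" "d \<in> B\<^sub>1"
    and xy: "trace N\<^sub>1 x = trace N\<^sub>1 y" and cd: "trace N\<^sub>1 c = trace N\<^sub>1 d"
    and "x \<noteq> y" "y \<noteq> c" "x < c"
  shows False
proof -
  note xy0 = trace_mono[OF xy le] and cd0 = trace_mono[OF cd le]
  have 1: "y < d" "e d y = e c x" "e c x < N\<^sub>0"
    using matched_less[OF A0, of x c y d] assms xy0 cd0 by auto
  \<comment> \<open>Otherwise \<open>x < c < y < d < x\<close>, as the second pair sends
    \<open>c < y\<close> to \<open>d < x\<close>.\<close>
  have "y < c"
  proof (rule ccontr)
    assume "\<not> y < c"
    then have "c < y"
      using \<open>y \<noteq> c\<close> by simp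
    then have "d < x"
      using matched_less(1)[OF A1, of c y d x] assms by auto
    then show False
      using \<open>x < c\<close> \<open>c < y\<close> \<open>y < d\<close> by simp
  qed
  then have 2: "x < d" "e d x = e c y" "e c y < N\<^sub>1"
    using matched_less[OF A1, of y c x d] assms by auto
  have "x < y \<longleftrightarrow> (e c x, e c y) \<in> pattern c"
    using pattern_iff_less[of x c y] \<open>x < c\<close> \<open>y < c\<close> \<open>x \<noteq> y\<close> by simp
  \<comment> \<open>Truncation loses nothing here: both codes are below \<open>N\<^sub>1\<close>,
    one by each matching.\<close>
  also have "\<dots> \<longleftrightarrow> (e c x, e c y) \<in> trace N\<^sub>1 c"
    using 1 2 le by (simp add: trace_def)
  also have "\<dots> \<longleftrightarrow> (e d y, e d x) \<in> pattern d"
    unfolding cd using 1 2 le by (simp add: trace_def)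
  also have "\<dots> \<longleftrightarrow> y < x"
    using pattern_iff_less[of y d x] 1 2 \<open>x \<noteq> y\<close> by simp
  finally show False
    using \<open>x \<noteq> y\<close> by auto
qed

text \<open>The element \<open>c\<close> lies above \<open>A\<^sub>1 \<inter> B\<^sub>1\<close>, and
  the second matching fixes \<open>x\<close>. Both matchings together give \<open>x\<close> and
  \<open>y\<close> the same code under \<open>e d\<close>.\<close>

lemma matched_common_part_eq:
  assumes A0: "matched N\<^sub>0 A\<^sub>0 B\<^sub>0" and A1: "matched N\<^sub>1 A\<^sub>1 B\<^sub>1" and le: "N\<^sub>0 \<le> N\<^sub>1"
    and "c \<in> A\<^sub>0 - B\<^sub>0" "d \<in> B\<^sub>0 - A\<^sub>0" "c \<in> A\<^sub>1 - B\<^sub>1" "d \<in> B\<^sub>1 - A\<^sub>1"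
    and cd: "trace N\<^sub>1 c = trace N\<^sub>1 d"
    and "x \<in> A\<^sub>0" "y \<in> B\<^sub>0" "trace N\<^sub>0 x = trace N\<^sub>0 y" "x \<in> A\<^sub>1 \<inter> B\<^sub>1" "y \<in> A\<^sub>1 \<inter> B\<^sub>1"
  shows "x = y"
proof -
  have "\<not> c < x"
    using matched_initial_segment[OF A1] assms by (auto simp: initial_segment_def)
  then have "x < c"
    using assms by (metis DiffD2 IntD2 linorder_neqE)
  have "y < d" "e d y = e c x"
    using matched_less[OF A0, of x c y d] assms trace_mono[OF cd le] \<open>x < c\<close> by auto
  moreover have "x < d" "e d x = e c x"
    using matched_less[OF A1, of x c x d] assms \<open>x < c\<close> by auto
  ultimately show ?thesis
    using e_eqD by metis
qed

text \<open>The witnesses \<open>c\<close>, \<open>d\<close> fix which set of one pair corresponds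
  to which of the other.\<close>

lemma matched_union_unique_aux:
  assumes A0: "matched N\<^sub>0 A\<^sub>0 B\<^sub>0" and A1: "matched N\<^sub>1 A\<^sub>1 B\<^sub>1" and le: "N\<^sub>0 \<le> N\<^sub>1"
    and un: "A\<^sub>0 \<union> B\<^sub>0 = A\<^sub>1 \<union> B\<^sub>1"
    and c: "c \<in> A\<^sub>0 - B\<^sub>0" "c \<in> A\<^sub>1 - B\<^sub>1" and d: "d \<in> B\<^sub>0 - A\<^sub>0" "d \<in> B\<^sub>1 - A\<^sub>1"
    and cd: "trace N\<^sub>1 c = trace N\<^sub>1 d"
  shows "A\<^sub>0 = A\<^sub>1 \<and> B\<^sub>0 = B\<^sub>1"
proof -
  \<comment> \<open>A converse to \<open>trace_mono\<close>: a partner of \<open>u\<close> for the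
    finer traces is also one for the coarser traces, where partners are unique.\<close>
  have refine: "trace N\<^sub>1 u = trace N\<^sub>1 v"
    if uv: "u \<in> A\<^sub>0 \<union> B\<^sub>0" "v \<in> A\<^sub>0 \<union> B\<^sub>0" "trace N\<^sub>0 u = trace N\<^sub>0 v" "u \<noteq> v"
      and u: "u \<notin> A\<^sub>1 \<inter> B\<^sub>1" for u v
  proof -
    obtain z where z: "z \<in> A\<^sub>1 \<union> B\<^sub>1" "z \<noteq> u" "trace N\<^sub>1 u = trace N\<^sub>1 z"
    proof (cases "u \<in> A\<^sub>1")
      case True
      with u have "u \<in> A\<^sub>1 - B\<^sub>1"
        by blast
      with A1 obtain z where "z \<in> B\<^sub>1 - A\<^sub>1" "trace N\<^sub>1 u = trace N\<^sub>1 z"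
        by (rule matched_partner)
      then show ?thesis
        using True that[of z] by auto
    next
      case False
      with uv un have "u \<in> B\<^sub>1 - A\<^sub>1"
        by blast
      with matched_sym[OF A1] obtain z where "z \<in> A\<^sub>1 - B\<^sub>1" "trace N\<^sub>1 u = trace N\<^sub>1 z"
        by (rule matched_partner)
      then show ?thesis
        using False that[of z] by auto
    qed
    have "trace N\<^sub>0 u = trace N\<^sub>0 z"
      using z(3) le by (rule trace_mono)
    then have "z = v"
      using uv z un matched_split[OF A0, of u z] matched_split[OF A0, of u v]
        matched_split[OF A0, of z v] by auto
    then show ?thesis
      using z by simp
  qed
  have pair: "x \<in> A\<^sub>1 - B\<^sub>1 \<and> y \<in> B\<^sub>1 - A\<^sub>1"
    if x: "x \<in> A\<^sub>0 - B\<^sub>0" and y: "y \<in> B\<^sub>0 - A\<^sub>0" and xy: "trace N\<^sub>0 x = trace N\<^sub>0 y" for x y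
  proof -
    have ne: "x \<noteq> y"
      using x y by auto
    then have "\<not> (x \<in> A\<^sub>1 \<inter> B\<^sub>1 \<and> y \<in> A\<^sub>1 \<inter> B\<^sub>1)"
      using matched_common_part_eq[OF A0 A1 le, of c d x y] c d cd x y xy by auto
    then have xy1: "trace N\<^sub>1 x = trace N\<^sub>1 y"
      using refine[of x y] refine[of y x] x y xy ne by auto
    have "\<not> (x \<in> B\<^sub>1 - A\<^sub>1 \<and> y \<in> A\<^sub>1 - B\<^sub>1)"
    proof
      assume *: "x \<in> B\<^sub>1 - A\<^sub>1 \<and> y \<in> A\<^sub>1 - B\<^sub>1"
      then consider "x < c" | "c < x"
        using c by (metis DiffD2 linorder_neqE DiffD1)
      then show False
      proof cases
        case 1
        then show False
          using no_crossing[OF A0 A1 le, of x c y d] * c d cd x y xy1 ne by auto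
      next
        case 2
        \<comment> \<open>Here \<open>c, d\<close> and \<open>x, y\<close> exchange roles, and so do
          the sets of the second pair.\<close>
        then show False
          using no_crossing[OF A0 matched_sym[OF A1] le, of c x d y] * c d cd x y xy1 by auto
      qed
    qed
    then show ?thesis
      using matched_split[OF A1, of x y] x y un xy1 ne by blast
  qed
  have sub: "A\<^sub>0 - B\<^sub>0 \<subseteq> A\<^sub>1 - B\<^sub>1" "B\<^sub>0 - A\<^sub>0 \<subseteq> B\<^sub>1 - A\<^sub>1"
  proof -
    show "A\<^sub>0 - B\<^sub>0 \<subseteq> A\<^sub>1 - B\<^sub>1"
    proof
      fix x assume "x \<in> A\<^sub>0 - B\<^sub>0"
      moreover from A0 this obtain y where "y \<in> B\<^sub>0 - A\<^sub>0" "trace N\<^sub>0 x = trace N\<^sub>0 y"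
        by (rule matched_partner)
      ultimately show "x \<in> A\<^sub>1 - B\<^sub>1"
        using pair by blast
    qed
    show "B\<^sub>0 - A\<^sub>0 \<subseteq> B\<^sub>1 - A\<^sub>1"
    proof
      fix y assume "y \<in> B\<^sub>0 - A\<^sub>0"
      moreover from matched_sym[OF A0] this obtain x where "x \<in> A\<^sub>0 - B\<^sub>0" "trace N\<^sub>0 y = trace N\<^sub>0 x"
        by (rule matched_partner)
      ultimately show "y \<in> B\<^sub>1 - A\<^sub>1"
        using pair[of x y] by simp
    qed
  qed
  \<comment> \<open>The opposite orientation would contradict \<open>sub\<close>.\<close>
  have sep: "x \<in> A\<^sub>0 - B\<^sub>0 \<and> y \<in> B\<^sub>0 - A\<^sub>0"
    if "x \<in> A\<^sub>1 - B\<^sub>1" "y \<in> B\<^sub>1 - A\<^sub>1" "trace N\<^sub>1 x = trace N\<^sub>1 y" for x y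
    using that matched_split[OF A0, of x y] trace_mono[OF that(3) le] un sub by blast
  have "A\<^sub>1 - B\<^sub>1 \<subseteq> A\<^sub>0 - B\<^sub>0"
  proof
    fix x assume "x \<in> A\<^sub>1 - B\<^sub>1"
    moreover from A1 this obtain y where "y \<in> B\<^sub>1 - A\<^sub>1" "trace N\<^sub>1 x = trace N\<^sub>1 y"
      by (rule matched_partner)
    ultimately show "x \<in> A\<^sub>0 - B\<^sub>0"
      using sep by blast
  qed
  moreover have "B\<^sub>1 - A\<^sub>1 \<subseteq> B\<^sub>0 - A\<^sub>0"
  proof
    fix y assume "y \<in> B\<^sub>1 - A\<^sub>1"
    moreover from matched_sym[OF A1] this obtain x where "x \<in> A\<^sub>1 - B\<^sub>1" "trace N\<^sub>1 y = trace N\<^sub>1 x"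
      by (rule matched_partner)
    ultimately show "y \<in> B\<^sub>0 - A\<^sub>0"
      using sep[of x y] by simp
  qed
  \<comment> \<open>The union and the two differences determine both sets.\<close>
  ultimately show ?thesis
    using sub un by blast
qed

text \<open>As \<open>A\<^sub>1 \<noteq> B\<^sub>1\<close>, some \<open>c\<close>, \<open>d\<close>
  are matched by the finer pair, hence by the coarser one up to swapping \<open>A\<^sub>0\<close>
  and \<open>B\<^sub>0\<close>.\<close>

lemma matched_union_unique:
  assumes A0: "matched N\<^sub>0 A\<^sub>0 B\<^sub>0" and A1: "matched N\<^sub>1 A\<^sub>1 B\<^sub>1" and le: "N\<^sub>0 \<le> N\<^sub>1"
    and un: "A\<^sub>0 \<union> B\<^sub>0 = A\<^sub>1 \<union> B\<^sub>1" and ne: "A\<^sub>1 \<noteq> B\<^sub>1"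
  shows "{A\<^sub>0, B\<^sub>0} = {A\<^sub>1, B\<^sub>1}"
proof -
  obtain c d where cd: "c \<in> A\<^sub>1 - B\<^sub>1" "d \<in> B\<^sub>1 - A\<^sub>1" "trace N\<^sub>1 c = trace N\<^sub>1 d"
    using matched_neq_obtains[OF A1 ne] .
  then have "c \<in> A\<^sub>0 - B\<^sub>0 \<and> d \<in> B\<^sub>0 - A\<^sub>0 \<or> c \<in> B\<^sub>0 - A\<^sub>0 \<and> d \<in> A\<^sub>0 - B\<^sub>0"
    using matched_split[OF A0, of c d] trace_mono[OF cd(3) le] un by blast
  then show ?thesis
  proof
    assume "c \<in> A\<^sub>0 - B\<^sub>0 \<and> d \<in> B\<^sub>0 - A\<^sub>0"
    then show ?thesis
      using matched_union_unique_aux[OF A0 A1 le un] cd by auto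
  next
    assume "c \<in> B\<^sub>0 - A\<^sub>0 \<and> d \<in> A\<^sub>0 - B\<^sub>0"
    moreover have "B\<^sub>0 \<union> A\<^sub>0 = A\<^sub>1 \<union> B\<^sub>1"
      using un by blast
    ultimately show ?thesis
      using matched_union_unique_aux[OF matched_sym[OF A0] A1 le, of c d] cd by auto
  qed
qed

section \<open>Colouring by natural numbers\<close>

lemma ex_matching_colouring:
  "\<exists>F :: 'a set \<Rightarrow> nat. \<forall>A B. finite A \<longrightarrow> finite B \<longrightarrow> F A = F B \<longrightarrow> (\<exists>N. matched N A B)"
proof -
  define N where "N A = (SOME n. separates n A)" for A
  have N: "separates (N A) A" if "finite A" for A
    unfolding N_def using ex_separates[OF that] by (rule someI_ex)
  define G where "G A = (N A, trace (N A) ` A, diagram (N A) A)" for A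
  define T :: "(nat \<times> nat) set set" where "T = {S. finite S}"
  define U where "U = (UNIV :: nat set) \<times> {S. finite S \<and> S \<subseteq> T} \<times>
    {S. finite S \<and> S \<subseteq> T \<times> T \<times> (UNIV :: nat set)}"
  have "countable T"
    unfolding T_def by (rule countable_Collect_finite)
  then have U: "countable U"
    unfolding U_def by (intro countable_SIGMA countable_Collect_finite_subset) auto
  have GU: "G A \<in> U" if "finite A" for A
    using that finite_diagram by (auto simp: G_def U_def T_def diagram_def finite_trace)
  have "matched (N A) A B"
    if "finite A" "finite B" "to_nat_on U (G A) = to_nat_on U (G B)" for A B
  proof -
    have "G A = G B"
      using U GU that by simp
    \<comment> \<open>Since \<open>N A\<close> is part of the colour, one number serves both
      sets.\<close>
    then have "N B = N A" and "trace (N A) ` A = trace (N B) ` B"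
      and "diagram (N A) A = diagram (N B) B"
      unfolding G_def prod.inject by metis+
    then show ?thesis
      using N that(1,2) unfolding matched_def by metis
  qed
  then show ?thesis
    by (intro exI[of _ "\<lambda>A. to_nat_on U (G A)"]) blast
qed

end

text \<open>Cantor's theorem puts the power set of \<open>nat\<close> above \<open>natLeq\<close>,
  hence at or above its successor cardinal.\<close>

lemma ex_inj_omega1_nat_set: "\<exists>r :: omega1 \<Rightarrow> nat set. inj r"
proof -
  have "natLeq =o |UNIV :: nat set|"
    using card_of_nat ordIso_symmetric by blast
  then have "natLeq <o |UNIV :: nat set set|"
    using card_of_Pow[of "UNIV :: nat set"] ordIso_ordLess_trans by (simp add: Pow_UNIV) blast
  then have "cardSuc natLeq \<le>o |UNIV :: nat set set|"
    using cardSuc_least[OF natLeq_Card_order card_of_Card_order] by blast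
  moreover have "|Field (cardSuc natLeq)| =o cardSuc natLeq"
    using cardSuc_Card_order[OF natLeq_Card_order] card_of_Field_ordIso by blast
  ultimately have "|Field (cardSuc natLeq)| \<le>o |UNIV :: nat set set|"
    using ordIso_ordLeq_trans by blast
  then obtain g :: "_ \<Rightarrow> nat set" where "inj_on g (Field (cardSuc natLeq))"
    by (auto simp: card_of_ordLeq[symmetric])
  then have "inj (\<lambda>x. g (Rep_omega1 x))"
    by (metis Rep_omega1 Rep_omega1_inject injI inj_onD)
  then show ?thesis
    by blast
qed

theorem theorem2:
  shows "\<exists>F :: omega1 set \<Rightarrow> nat.
    (\<forall>A\<in>Fpow UNIV. \<forall>B\<in>Fpow UNIV. F A = F B \<longrightarrow> card A = card B) \<and>
    (\<forall>A\<in>Fpow UNIV. \<forall>B\<in>Fpow UNIV. F A = F B \<longrightarrow>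
        initial_segment (A \<inter> B) A \<and> initial_segment (A \<inter> B) B) \<and>
    \<not> (\<exists>A\<^sub>0\<in>Fpow UNIV. \<exists>B\<^sub>0\<in>Fpow UNIV. \<exists>A\<^sub>1\<in>Fpow UNIV. \<exists>B\<^sub>1\<in>Fpow UNIV.
        A\<^sub>0 \<union> B\<^sub>0 = A\<^sub>1 \<union> B\<^sub>1 \<and> F A\<^sub>0 = F B\<^sub>0 \<and> F A\<^sub>1 = F B\<^sub>1 \<and>
        A\<^sub>0 \<noteq> B\<^sub>0 \<and> A\<^sub>1 \<noteq> B\<^sub>1 \<and> {A\<^sub>0, B\<^sub>0} \<noteq> {A\<^sub>1, B\<^sub>1})"
proof -
  obtain r :: "omega1 \<Rightarrow> nat set" where "inj r"
    using ex_inj_omega1_nat_set by blast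
  interpret segment_coding "\<lambda>y. to_nat_on {..<y}" r
    using \<open>inj r\<close> countable_lessThan_omega1 by unfold_locales auto
  obtain F :: "omega1 set \<Rightarrow> nat"
    where F: "\<And>A B. A \<in> Fpow UNIV \<Longrightarrow> B \<in> Fpow UNIV \<Longrightarrow> F A = F B \<Longrightarrow> \<exists>N. matched N A B"
    using ex_matching_colouring by (auto simp: Fpow_def)
  show ?thesis
  proof (intro exI[of _ F] conjI ballI impI)
    fix A B :: "omega1 set"
    assume "A \<in> Fpow UNIV" "B \<in> Fpow UNIV" "F A = F B"
    then obtain N where N: "matched N A B"
      using F by blast
    then show "card A = card B"
      by (rule matched_card)
    show "initial_segment (A \<inter> B) A"
      using N by (rule matched_initial_segment)
    show "initial_segment (A \<inter> B) B"
      using matched_initial_segment[OF matched_sym[OF N]] by (simp add: Int_commute)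
  next
    have "{A\<^sub>0, B\<^sub>0} = {A\<^sub>1, B\<^sub>1}"
      if assms: "A\<^sub>0 \<in> Fpow UNIV" "B\<^sub>0 \<in> Fpow UNIV" "A\<^sub>1 \<in> Fpow UNIV" "B\<^sub>1 \<in> Fpow UNIV"
        and un: "A\<^sub>0 \<union> B\<^sub>0 = A\<^sub>1 \<union> B\<^sub>1" and eq: "F A\<^sub>0 = F B\<^sub>0" "F A\<^sub>1 = F B\<^sub>1"
        and ne: "A\<^sub>0 \<noteq> B\<^sub>0" "A\<^sub>1 \<noteq> B\<^sub>1" for A\<^sub>0 B\<^sub>0 A\<^sub>1 B\<^sub>1
    proof -
      obtain N\<^sub>0 N\<^sub>1 where N: "matched N\<^sub>0 A\<^sub>0 B\<^sub>0" "matched N\<^sub>1 A\<^sub>1 B\<^sub>1"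
        using F[of A\<^sub>0 B\<^sub>0] F[of A\<^sub>1 B\<^sub>1] assms eq by blast
      show ?thesis
      proof (cases "N\<^sub>0 \<le> N\<^sub>1")
        case True
        then show ?thesis
          using matched_union_unique[OF N _ un] ne by blast
      next
        case False
        \<comment> \<open>The pairs trade places, so the inequality needed is now
          \<open>A\<^sub>0 \<noteq> B\<^sub>0\<close>.\<close>
        then show ?thesis
          using matched_union_unique[OF N(2,1) _ un[symmetric]] ne by auto
      qed
    qed
    then show "\<not> (\<exists>A\<^sub>0\<in>Fpow UNIV. \<exists>B\<^sub>0\<in>Fpow UNIV. \<exists>A\<^sub>1\<in>Fpow UNIV. \<exists>B\<^sub>1\<in>Fpow UNIV.
        A\<^sub>0 \<union> B\<^sub>0 = A\<^sub>1 \<union> B\<^sub>1 \<and> F A\<^sub>0 = F B\<^sub>0 \<and> F A\<^sub>1 = F B\<^sub>1 \<and>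
        A\<^sub>0 \<noteq> B\<^sub>0 \<and> A\<^sub>1 \<noteq> B\<^sub>1 \<and> {A\<^sub>0, B\<^sub>0} \<noteq> {A\<^sub>1, B\<^sub>1})"
      by meson
  qed
qed

end
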